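(* Let $T>0$ and let $\Omega\subset\mathbb{R}^n$ be a domain with the following property: for any $x_0\in\partial\Omega$ and any $s>0$ small, there exist $\nu\in C(\overline{\Omega}\cap B_s(x_0);\mathbb{R}^n)$ and $c>0$ small such that $B_{c\tau}(y+\tau\nu(y))\subset\Omega$ for all $y\in\overline{\Omega}\cap B_s(x_0)$ and $0<\tau\le c$. Let $H\in C(\Omega\times\mathbb{R}\times\mathbb{R}^n\times\mathbb{S}^n)$ be an elliptic operator, i.e. $H(x,r,p,X)\le H(x,r,p,Y)$ for all $x\in\Omega$, $r\in\mathbb{R}$, $p\in\mathbb{R}^n$ and $X,Y\in\mathbb{S}^n$ with $X\ge Y$. Assume that for some $G\in C(\partial\Omega\times\mathbb{R})$ and any modulus of continuity $\omega$, $$\sup\{|H(x,r,p,X)-G(y,r)|:\ x\in\Omega,\ y\in\partial\Omega,\ |x-y|\le\delta,\ r\in\mathbb{R},\ |p|\le\omega(\delta)/\delta,\ |X|\le\omega(\delta)/\delta^2\}\to0\quad\text{as }\delta\to0.$$ Assume that $r\mapsto H(x,r,p,X)$ is nondecreasing for all $x\in\Omega$, $p\in\mathbb{R}^n$, $X\in\mathbb{S}^n$. Assume in addition that $$\sup_{x\in\Omega}|H(x,0,p,X)|\to0\quad\text{as }|p|,|X|\to0.$$ If $u\in C(\Omega\times[0,T))$ is a bounded viscosity solution of $$u_t+H(x,u,\nabla u,\nabla^2u)=0\quad\text{in }\Omega\times(0,T)$$ that can be extended to a function in $C(\overline{\Omega}\times[0,T))$ with $u(\cdot,0)=0$ in $\overline{\Omega}$,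 then $u\equiv0$ in $\Omega\times[0,T)$.
   Context: $\mathbb{S}^n$ is the set of all real symmetric $n\times n$ matrices with the usual partial order; $B_r(x)$ is the open ball centered at $x$ with radius $r$; $\nabla,\nabla^2$ are the gradient and Hessian in the space variable; $\Omega_T=\Omega\times(0,T)$. A modulus of continuity is a nonnegative increasing function $\omega\in C([0,\infty))$ with $\omega(0)=0$. Viscosity solutions. A locally bounded upper (resp. lower) semicontinuous function $u$ in $\Omega_T$ is a viscosity subsolution (resp. supersolution) of $u_t+H(x,u,\nabla u,\nabla^2u)=0$ in $\Omega_T$ if whenever $(x_0,t_0)\in\Omega_T$ and $\varphi\in C^2(\Omega_T)$ are such that $u-\varphi$ attains a local maximum (resp. minimum) at $(x_0,t_0)$, one has $\varphi_t(x_0,t_0)+H(x_0,u(x_0,t_0),\nabla\varphi(x_0,t_0),\nabla^2\varphi(x_0,t_0))\le0$ (resp. $\ge0$). A continuous function is a viscosity solution if it is both a viscosity subsolution and a viscosity supersolution. *)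

theory Defs
  imports "HOL-Analysis.Analysis"
begin

definition sym_matrices :: "(real ^ 'n ^ 'n) set"
  where "sym_matrices = {X. transpose X = X}"

definition loewner_le :: "real ^ 'n ^ 'n \<Rightarrow> real ^ 'n ^ 'n \<Rightarrow> bool"
  where "loewner_le X Y \<longleftrightarrow> (\<forall>\<xi>. \<xi> \<bullet> (X *v \<xi>) \<le> \<xi> \<bullet> (Y *v \<xi>))"

text \<open>The operator \<open>H\<close> is a function of arbitrary square matrices, but only its values at
  symmetric matrices (and at points \<open>x \<in> \<Omega>\<close>) are ever used or constrained.\<close>

definition elliptic_on ::
  "(real ^ 'n) set \<Rightarrow> (real ^ 'n \<Rightarrow> real \<Rightarrow> real ^ 'n \<Rightarrow> real ^ 'n ^ 'n \<Rightarrow> real) \<Rightarrow> bool"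
  where "elliptic_on \<Omega> H \<longleftrightarrow>
    (\<forall>x\<in>\<Omega>. \<forall>r p. \<forall>X\<in>sym_matrices. \<forall>Y\<in>sym_matrices. loewner_le Y X \<longrightarrow> H x r p X \<le> H x r p Y)"

definition modulus_of_continuity :: "(real \<Rightarrow> real) \<Rightarrow> bool"
  where "modulus_of_continuity \<omega> \<longleftrightarrow>
    continuous_on {0..} \<omega> \<and> mono_on {0..} \<omega> \<and> (\<forall>r\<ge>0. 0 \<le> \<omega> r) \<and> \<omega> 0 = 0"

definition interior_cone_property :: "(real ^ 'n) set \<Rightarrow> bool"
  where "interior_cone_property \<Omega> \<longleftrightarrow>
    (\<forall>x0\<in>frontier \<Omega>. \<forall>\<^sub>F s in at_right 0.
      \<exists>\<nu>. \<exists>c>0. continuous_on (closure \<Omega> \<inter> ball x0 s) \<nu> \<and>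
        (\<forall>y\<in>closure \<Omega> \<inter> ball x0 s. \<forall>\<tau>. 0 < \<tau> \<and> \<tau> \<le> c \<longrightarrow> ball (y + \<tau> *\<^sub>R \<nu> y) (c * \<tau>) \<subseteq> \<Omega>))"

text \<open>Twice continuously Frechet differentiable; meant for open \<open>S\<close>.\<close>

definition C2_on :: "'a::real_normed_vector set \<Rightarrow> ('a \<Rightarrow> real) \<Rightarrow> bool"
  where "C2_on S \<phi> \<longleftrightarrow>
    (\<exists>(D :: 'a \<Rightarrow> 'a \<Rightarrow>\<^sub>L real) (D2 :: 'a \<Rightarrow> 'a \<Rightarrow>\<^sub>L ('a \<Rightarrow>\<^sub>L real)).
      (\<forall>z\<in>S. (\<phi> has_derivative blinfun_apply (D z)) (at z)) \<and>
      (\<forall>z\<in>S. (D has_derivative blinfun_apply (D2 z)) (at z)) \<and>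
      continuous_on S D2)"

definition partial_deriv :: "'n \<Rightarrow> (real ^ 'n \<Rightarrow> real) \<Rightarrow> real ^ 'n \<Rightarrow> real"
  where "partial_deriv i f x = deriv (\<lambda>h. f (x + h *\<^sub>R axis i 1)) 0"

definition gradient :: "(real ^ 'n \<Rightarrow> real) \<Rightarrow> real ^ 'n \<Rightarrow> real ^ 'n"
  where "gradient f x = (\<chi> i. partial_deriv i f x)"

definition hessian :: "(real ^ 'n \<Rightarrow> real) \<Rightarrow> real ^ 'n \<Rightarrow> real ^ 'n ^ 'n"
  where "hessian f x = (\<chi> i j. partial_deriv i (partial_deriv j f) x)"

definition locally_bounded_on :: "'a::metric_space set \<Rightarrow> ('a \<Rightarrow> real) \<Rightarrow> bool"
  where "locally_bounded_on S u \<longleftrightarrow> (\<forall>z\<in>S. \<exists>r>0. bounded (u ` (S \<inter> ball z r)))"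

definition usc_on :: "'a::topological_space set \<Rightarrow> ('a \<Rightarrow> real) \<Rightarrow> bool"
  where "usc_on S u \<longleftrightarrow> (\<forall>z\<in>S. \<forall>a. u z < a \<longrightarrow> (\<forall>\<^sub>F w in at z within S. u w < a))"

definition lsc_on :: "'a::topological_space set \<Rightarrow> ('a \<Rightarrow> real) \<Rightarrow> bool"
  where "lsc_on S u \<longleftrightarrow> (\<forall>z\<in>S. \<forall>a. a < u z \<longrightarrow> (\<forall>\<^sub>F w in at z within S. a < u w))"

definition local_max_at :: "'a::metric_space set \<Rightarrow> ('a \<Rightarrow> real) \<Rightarrow> 'a \<Rightarrow> bool"
  where "local_max_at S f z0 \<longleftrightarrow> (\<exists>r>0. \<forall>z\<in>S \<inter> ball z0 r. f z \<le> f z0)"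

definition local_min_at :: "'a::metric_space set \<Rightarrow> ('a \<Rightarrow> real) \<Rightarrow> 'a \<Rightarrow> bool"
  where "local_min_at S f z0 \<longleftrightarrow> (\<exists>r>0. \<forall>z\<in>S \<inter> ball z0 r. f z0 \<le> f z)"

text \<open>Functions of space and time are functions of pairs \<open>(x, t)\<close>. The equation is
  \<open>u\<^sub>t + H(x, u, \<nabla>u, \<nabla>\<^sup>2u) = 0\<close> in \<open>\<Omega> \<times> (0, T)\<close>.\<close>

definition viscosity_subsolution ::
  "(real ^ 'n) set \<Rightarrow> real \<Rightarrow> (real ^ 'n \<Rightarrow> real \<Rightarrow> real ^ 'n \<Rightarrow> real ^ 'n ^ 'n \<Rightarrow> real)
    \<Rightarrow> ((real ^ 'n) \<times> real \<Rightarrow> real) \<Rightarrow> bool"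
  where "viscosity_subsolution \<Omega> T H u \<longleftrightarrow>
    locally_bounded_on (\<Omega> \<times> {0<..<T}) u \<and> usc_on (\<Omega> \<times> {0<..<T}) u \<and>
    (\<forall>x0\<in>\<Omega>. \<forall>t0\<in>{0<..<T}. \<forall>\<phi>.
      C2_on (\<Omega> \<times> {0<..<T}) \<phi> \<and>
      local_max_at (\<Omega> \<times> {0<..<T}) (\<lambda>z. u z - \<phi> z) (x0, t0) \<longrightarrow>
        deriv (\<lambda>t. \<phi> (x0, t)) t0 +
        H x0 (u (x0, t0)) (gradient (\<lambda>x. \<phi> (x, t0)) x0) (hessian (\<lambda>x. \<phi> (x, t0)) x0) \<le> 0)"

definition viscosity_supersolution ::
  "(real ^ 'n) set \<Rightarrow> real \<Rightarrow> (real ^ 'n \<Rightarrow> real \<Rightarrow> real ^ 'n \<Rightarrow> real ^ 'n ^ 'n \<Rightarrow> real)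
    \<Rightarrow> ((real ^ 'n) \<times> real \<Rightarrow> real) \<Rightarrow> bool"
  where "viscosity_supersolution \<Omega> T H u \<longleftrightarrow>
    locally_bounded_on (\<Omega> \<times> {0<..<T}) u \<and> lsc_on (\<Omega> \<times> {0<..<T}) u \<and>
    (\<forall>x0\<in>\<Omega>. \<forall>t0\<in>{0<..<T}. \<forall>\<phi>.
      C2_on (\<Omega> \<times> {0<..<T}) \<phi> \<and>
      local_min_at (\<Omega> \<times> {0<..<T}) (\<lambda>z. u z - \<phi> z) (x0, t0) \<longrightarrow>
        deriv (\<lambda>t. \<phi> (x0, t)) t0 +
        H x0 (u (x0, t0)) (gradient (\<lambda>x. \<phi> (x, t0)) x0) (hessian (\<lambda>x. \<phi> (x, t0)) x0) \<ge> 0)"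

definition viscosity_solution ::
  "(real ^ 'n) set \<Rightarrow> real \<Rightarrow> (real ^ 'n \<Rightarrow> real \<Rightarrow> real ^ 'n \<Rightarrow> real ^ 'n ^ 'n \<Rightarrow> real)
    \<Rightarrow> ((real ^ 'n) \<times> real \<Rightarrow> real) \<Rightarrow> bool"
  where "viscosity_solution \<Omega> T H u \<longleftrightarrow>
    continuous_on (\<Omega> \<times> {0<..<T}) u \<and>
    viscosity_subsolution \<Omega> T H u \<and> viscosity_supersolution \<Omega> T H u"

text \<open>The supremum is taken in \<^typ>\<open>ennreal\<close>: it is \<open>\<infinity>\<close> for an unbounded family, and \<open>0\<close> for
  the empty one, which occurs when \<open>\<Omega>\<close> has no boundary.\<close>

definition boundary_oscillation ::
  "(real ^ 'n) set \<Rightarrow> (real ^ 'n \<Rightarrow> real \<Rightarrow> real ^ 'n \<Rightarrow> real ^ 'n ^ 'n \<Rightarrow> real)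
    \<Rightarrow> (real ^ 'n \<Rightarrow> real \<Rightarrow> real) \<Rightarrow> (real \<Rightarrow> real) \<Rightarrow> real \<Rightarrow> ennreal"
  where "boundary_oscillation \<Omega> H G \<omega> \<delta> =
    Sup {ennreal \<bar>H x r p X - G y r\<bar> | x y r p X.
      x \<in> \<Omega> \<and> y \<in> frontier \<Omega> \<and> norm (x - y) \<le> \<delta> \<and>
      norm p \<le> \<omega> \<delta> / \<delta> \<and> X \<in> sym_matrices \<and> norm X \<le> \<omega> \<delta> / \<delta>\<^sup>2}"

end

(* The maximum M of v - alpha / (T - t) - gamma |x|^2 over the closure of Omega, if positive, is
   attained at some (y, s) with s > 0. If y is interior, gamma |y|^2 is at most sup v, so gradient
   2 gamma y and Hessian 2 gamma I of the test function are small when gamma is, and the equation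
   contradicts alpha / (T - s)^2 > 0. If y is a boundary point with interior cone direction nu, one
   adds the penalty beta |x - y - tau nu|^2, normalised so that on the sphere of radius c tau / 2
   around y + tau nu it exceeds the loss k(tau) incurred by moving from y to y + tau nu. The
   maximum then moves into Omega, at distance O(tau) from y, while gradient and Hessian are
   o(1 / tau) and o(1 / tau^2) because k(tau) tends to 0. So H is close to G(y, 0) = 0 there, and
   the same contradiction arises. *)

theory Submission
  imports Defs
begin

section \<open>Majorants that are moduli of continuity\<close>

text \<open>The boundary hypothesis on the operator accepts only moduli of continuity, whereas the
  barrier argument produces a bound that merely tends to 0 and need not be monotone. This lemma
  bridges the gap.\<close>

lemma modulus_of_continuity_majorant:
  fixes f :: "real \<Rightarrow> real"
  assumes "(f \<longlongrightarrow> 0) (at_right 0)"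
  obtains \<omega> where "modulus_of_continuity \<omega>" "\<forall>\<^sub>F s in at_right 0. f s \<le> \<omega> s"
proof -
  have small: "\<exists>a>0. \<forall>r. 0 < r \<and> r < a \<longrightarrow> \<bar>f r\<bar> < e" if "e > 0" for e
    using tendstoD[OF assms that] unfolding eventually_at_right_field by (auto simp: dist_real_def)
  obtain a where a: "a > 0" "\<And>r. 0 < r \<Longrightarrow> r < a \<Longrightarrow> \<bar>f r\<bar> < 1"
    using small[of 1] by auto
  define A where "A = {0<..<a}"
  \<comment> \<open>At \<open>r = s\<close> the weight is 1, so the supremum dominates
    \<open>f\<close> on \<open>A\<close>. For fixed \<open>r\<close> the weight is nondecreasing in
    \<open>s\<close> and grows at most linearly, which makes the supremum monotone and continuous;
    restricting to \<open>r < a\<close> keeps it below 1.\<close>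
  define g where "g r s = \<bar>f r\<bar> * min 1 (s / r)" for r s
  define \<omega> where "\<omega> s = (SUP r\<in>A. g r s)" for s
  have A: "A \<noteq> {}" and A_pos: "\<And>r. r \<in> A \<Longrightarrow> 0 < r" using a by (auto simp: A_def)
  have g_le: "g r s \<le> \<bar>f r\<bar>" if "r \<in> A" for r s
    unfolding g_def by (rule mult_left_le) auto
  have g_le1: "g r s \<le> 1" if "r \<in> A" for r s
    using g_le[OF that, of s] a(2)[of r] that by (auto simp: A_def)
  have bdd: "bdd_above ((\<lambda>r. g r s) ` A)" for s
    using g_le1 by (auto intro!: bdd_aboveI)
  have upper: "g r s \<le> \<omega> s" if "r \<in> A" for r s
    unfolding \<omega>_def by (rule cSUP_upper[OF that bdd])
  have least: "\<omega> s \<le> b" if "\<And>r. r \<in> A \<Longrightarrow> g r s \<le> b" for s b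
    unfolding \<omega>_def by (rule cSUP_least[OF A that])
  have g_nonneg: "0 \<le> g r s" if "r \<in> A" "0 \<le> s" for r s
    using A_pos[OF that(1)] that(2) by (auto simp: g_def)
  have nonneg: "0 \<le> \<omega> s" if "0 \<le> s" for s
  proof -
    obtain r where r: "r \<in> A" using A by auto
    show ?thesis using g_nonneg[OF r that] upper[OF r, of s] by linarith
  qed
  have mono: "\<omega> s \<le> \<omega> s'" if "0 \<le> s" "s \<le> s'" for s s'
  proof (rule least)
    fix r assume r: "r \<in> A"
    have "s / r \<le> s' / r" using A_pos[OF r] that by (simp add: divide_right_mono)
    then have "g r s \<le> g r s'" unfolding g_def by (intro mult_left_mono) auto
    then show "g r s \<le> \<omega> s'" using upper[OF r, of s'] by linarith
  qed
  have zero: "\<omega> 0 = 0"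
    using nonneg[of 0] least[of 0 0] by (auto simp: g_def)
  have le1: "\<omega> s \<le> 1" for s using g_le1 by (rule least)
  \<comment> \<open>The quotient \<open>\<omega> s / s\<close> is nonincreasing, because this holds
    for each weight \<open>min 1 (s / r)\<close>. Together with \<open>\<omega> \<le> 1\<close> it
    yields a Lipschitz bound with constant \<open>1 / m\<close> on \<open>[m, \<infinity>)\<close>,
    hence continuity away from 0.\<close>
  have sub: "\<omega> s' \<le> s' / s * \<omega> s" if "0 < s" "s \<le> s'" for s s'
  proof (rule least)
    fix r assume r: "r \<in> A"
    have "min 1 (s' / r) \<le> s' / s * min 1 (s / r)"
      using that A_pos[OF r] by (auto simp: min_def field_simps)
    then have "g r s' \<le> s' / s * g r s"
      unfolding g_def using mult_left_mono[of "min 1 (s' / r)" _ "\<bar>f r\<bar>"] by (metis abs_ge_zero mult.left_commute)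
    also have "\<dots> \<le> s' / s * \<omega> s" using that upper[OF r] by (intro mult_left_mono) auto
    finally show "g r s' \<le> s' / s * \<omega> s" .
  qed
  have incr: "\<omega> s' - \<omega> s \<le> (s' - s) / m" if "0 < m" "m \<le> s" "s \<le> s'" for m s s'
  proof -
    have "\<omega> s' - \<omega> s \<le> (s' / s - 1) * \<omega> s" using sub[of s s'] that by (simp add: algebra_simps)
    also have "\<dots> \<le> (s' / s - 1) * 1" using that le1[of s] by (intro mult_left_mono) auto
    also have "\<dots> = (s' - s) / s" using that by (simp add: field_simps)
    also have "\<dots> \<le> (s' - s) / m" using that by (intro divide_left_mono) auto
    finally show ?thesis .
  qed
  have lip: "\<bar>\<omega> s' - \<omega> s\<bar> \<le> \<bar>s' - s\<bar> / m" if "0 < m" "m \<le> s" "m \<le> s'" for m s s'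
    using incr[of m s s'] incr[of m s' s] mono[of s s'] mono[of s' s] that
    by (cases "s \<le> s'") (auto simp: abs_if)
  have "continuous_on {0..} \<omega>"
    unfolding continuous_on_iff
  proof (intro ballI allI impI)
    fix s e :: real assume s: "s \<in> {0..}" and e: "e > 0"
    show "\<exists>d>0. \<forall>s'\<in>{0..}. dist s' s < d \<longrightarrow> dist (\<omega> s') (\<omega> s) < e"
    proof (cases "s = 0")
      case True
      obtain \<eta> where \<eta>: "\<eta> > 0" "\<And>r. 0 < r \<Longrightarrow> r < \<eta> \<Longrightarrow> \<bar>f r\<bar> < e / 2"
        using small[of "e / 2"] e by auto
      \<comment> \<open>Continuity at 0: for \<open>r < \<eta>\<close> the factor
        \<open>\<bar>f r\<bar>\<close> is small, and for \<open>r \<ge> \<eta>\<close> the weight is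
        at most \<open>s' / \<eta>\<close>.\<close>
      have "\<omega> s' < e" if s': "0 \<le> s'" "s' < e / 2 * \<eta>" for s'
      proof -
        have "\<omega> s' \<le> e / 2"
        proof (rule least)
          fix r assume r: "r \<in> A"
          show "g r s' \<le> e / 2"
          proof (cases "r < \<eta>")
            case True
            then show ?thesis using \<eta>(2)[of r] g_le[OF r, of s'] A_pos[OF r] by linarith
          next
            case False
            have "g r s' \<le> 1 * (s' / r)"
              unfolding g_def using a(2)[of r] r s' by (intro mult_mono) (auto simp: A_def)
            also have "\<dots> \<le> s' / \<eta>" using False \<eta> s' by (simp add: frac_le)
            also have "\<dots> \<le> e / 2" using s' \<eta> by (simp add: field_simps)
            finally show ?thesis .
          qed
        qed
        then show ?thesis using e by linarith
      qed
      then show ?thesis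
        using True zero nonneg \<eta> e
        by (intro exI[of _ "e / 2 * \<eta>"]) (auto simp: dist_real_def)
    next
      case False
      then have s0: "0 < s" using s by auto
      have "dist (\<omega> s') (\<omega> s) < e" if "dist s' s < min (s / 2) (e * (s / 2))" for s'
      proof -
        have "\<bar>\<omega> s' - \<omega> s\<bar> \<le> \<bar>s' - s\<bar> / (s / 2)"
          using that s0 by (intro lip) (auto simp: dist_real_def abs_if split: if_splits)
        also have "\<dots> < e" using that s0 by (simp add: dist_real_def pos_divide_less_eq)
        finally show ?thesis by (simp add: dist_real_def)
      qed
      then show ?thesis using s0 e by (intro exI[of _ "min (s / 2) (e * (s / 2))"]) auto
    qed
  qed
  then have "modulus_of_continuity \<omega>"
    using mono nonneg zero by (auto simp: modulus_of_continuity_def intro!: mono_onI)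
  moreover have "\<forall>\<^sub>F s in at_right 0. f s \<le> \<omega> s"
    unfolding eventually_at_right_field
  proof (intro exI conjI allI impI)
    show "0 < a" by fact
    fix s assume "0 < s" "s < a"
    then have "\<bar>f s\<bar> \<le> \<omega> s" using upper[of s s] by (auto simp: A_def g_def)
    then show "f s \<le> \<omega> s" by linarith
  qed
  ultimately show ?thesis using that by blast
qed

section \<open>Test functions and their derivatives\<close>

text \<open>One family covers every test function of the proof, so the coefficients carry no sign:
  \<beta> is 0 at interior maxima, positive near the boundary, and all three coefficients are
  negated when testing from below. The first term forces maxima away from the final time, the second
  away from spatial infinity.\<close>

definition barrier ::
  "real \<Rightarrow> real \<Rightarrow> real \<Rightarrow> real \<Rightarrow> real ^ 'n \<Rightarrow> (real ^ 'n) \<times> real \<Rightarrow> real"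
  where "barrier T \<alpha> \<gamma> \<beta> z = (\<lambda>(x, t). \<alpha> / (T - t) + \<gamma> * (x \<bullet> x) + \<beta> * ((x - z) \<bullet> (x - z)))"

lemma barrier_uminus: "barrier T (- \<alpha>) (- \<gamma>) (- \<beta>) z w = - barrier T \<alpha> \<gamma> \<beta> z w"
  by (simp add: barrier_def split: prod.split)

lemma C2_on_barrier:
  fixes \<Omega> :: "(real ^ 'n) set"
  shows "C2_on (\<Omega> \<times> {0<..<T}) (barrier T \<alpha> \<gamma> \<beta> z)"
proof -
  define F :: "real ^ 'n \<Rightarrow> ((real ^ 'n) \<times> real) \<Rightarrow>\<^sub>L real" where "F v = blinfun_inner_left v o\<^sub>L fst_blinfun" for v
  have F: "blinfun_apply (F v) w = fst w \<bullet> v" for v w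
    by (simp add: F_def)
  have F_lin: "bounded_linear F"
    unfolding F_def
    by (rule bounded_linear_compose[OF bounded_bilinear.bounded_linear_left[OF bounded_bilinear_blinfun_compose]
          bounded_linear_blinfun_inner_left])
  \<comment> \<open>\<open>C1\<close> and \<open>C2\<close> are the time and space parts of the
    second derivative. Only the scalar factor in front of \<open>C1\<close> varies with the point,
    so continuity of \<open>D2\<close> reduces to that of a rational function of time.\<close>
  define C1 :: "((real ^ 'n) \<times> real) \<Rightarrow>\<^sub>L ((real ^ 'n) \<times> real) \<Rightarrow>\<^sub>L real"
    where "C1 = Blinfun (\<lambda>w. snd w *\<^sub>R snd_blinfun)"
  define C2 where "C2 = Blinfun (\<lambda>w :: (real ^ 'n) \<times> real. (2 * (\<gamma> + \<beta>)) *\<^sub>R F (fst w))"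
  have C1: "blinfun_apply C1 = (\<lambda>w. snd w *\<^sub>R snd_blinfun)"
    unfolding C1_def by (rule bounded_linear_Blinfun_apply)
      (rule bounded_linear_compose[OF bounded_linear_scaleR_left bounded_linear_snd])
  have C2: "blinfun_apply C2 = (\<lambda>w. (2 * (\<gamma> + \<beta>)) *\<^sub>R F (fst w))"
    unfolding C2_def by (rule bounded_linear_Blinfun_apply)
      (rule bounded_linear_compose[OF bounded_linear_scaleR_right bounded_linear_compose[OF F_lin bounded_linear_fst]])
  define D where "D w = (\<alpha> / (T - snd w)\<^sup>2) *\<^sub>R snd_blinfun + F ((2 * \<gamma>) *\<^sub>R fst w + (2 * \<beta>) *\<^sub>R (fst w - z))" for w :: "(real ^ 'n) \<times> real"
  define D2 where "D2 w = (2 * \<alpha> / (T - snd w) ^ 3) *\<^sub>R C1 + C2" for w :: "(real ^ 'n) \<times> real"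
  show ?thesis
    unfolding C2_on_def
  proof (intro exI[of _ D] exI[of _ D2] conjI ballI)
    fix w assume "w \<in> \<Omega> \<times> {0<..<T}"
    then have w: "T - snd w \<noteq> 0" by auto
    have time1: "((\<lambda>w :: (real ^ 'n) \<times> real. \<alpha> / (T - snd w)) has_derivative (\<lambda>h. \<alpha> / (T - snd w)\<^sup>2 * snd h)) (at w)"
      using w by (auto intro!: derivative_eq_intros simp: power2_eq_square divide_simps)
    have space1: "((\<lambda>w :: (real ^ 'n) \<times> real. \<gamma> * (fst w \<bullet> fst w) + \<beta> * ((fst w - z) \<bullet> (fst w - z)))
        has_derivative (\<lambda>h. fst h \<bullet> ((2 * \<gamma>) *\<^sub>R fst w + (2 * \<beta>) *\<^sub>R (fst w - z)))) (at w)"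
      by (auto intro!: derivative_eq_intros simp: algebra_simps inner_commute)
    show "(barrier T \<alpha> \<gamma> \<beta> z has_derivative blinfun_apply (D w)) (at w)"
      using has_derivative_add[OF time1 space1]
      by (simp add: barrier_def case_prod_beta' add.assoc D_def plus_blinfun.rep_eq scaleR_blinfun.rep_eq F)
    have time2: "((\<lambda>w :: (real ^ 'n) \<times> real. \<alpha> / (T - snd w)\<^sup>2) has_derivative (\<lambda>h. 2 * \<alpha> / (T - snd w) ^ 3 * snd h)) (at w)"
      using w by (auto intro!: derivative_eq_intros simp: power2_eq_square power3_eq_cube divide_simps)
    have space2: "((\<lambda>w :: (real ^ 'n) \<times> real. (2 * \<gamma>) *\<^sub>R fst w + (2 * \<beta>) *\<^sub>R (fst w - z))
        has_derivative (\<lambda>h. (2 * (\<gamma> + \<beta>)) *\<^sub>R fst h)) (at w)"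
      by (auto intro!: derivative_eq_intros simp: algebra_simps)
    have "(D has_derivative (\<lambda>h. (2 * \<alpha> / (T - snd w) ^ 3 * snd h) *\<^sub>R snd_blinfun + F ((2 * (\<gamma> + \<beta>)) *\<^sub>R fst h))) (at w)"
      unfolding D_def[abs_def]
      by (intro has_derivative_add bounded_linear.has_derivative[OF F_lin space2]
          bounded_linear.has_derivative[OF bounded_linear_scaleR_left time2])
    then show "(D has_derivative blinfun_apply (D2 w)) (at w)"
      by (simp add: D2_def blinfun.add_left blinfun.scaleR_left C1 C2 bounded_linear.linear[OF F_lin, THEN linear_scale] plus_blinfun.rep_eq scaleR_blinfun.rep_eq)
  next
    show "continuous_on (\<Omega> \<times> {0<..<T}) D2"
      unfolding D2_def by (intro continuous_intros) auto
  qed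
qed

lemma deriv_barrier_time:
  assumes "t \<noteq> T"
  shows "deriv (\<lambda>t. barrier T \<alpha> \<gamma> \<beta> z (x, t)) t = \<alpha> / (T - t)\<^sup>2"
proof -
  have "((\<lambda>t. \<alpha> / (T - t) + c) has_real_derivative \<alpha> / (T - t)\<^sup>2) (at t)" for c
    using assms by (auto intro!: derivative_eq_intros simp: power2_eq_square)
  then show ?thesis
    unfolding barrier_def prod.case add.assoc by (rule DERIV_imp_deriv)
qed

lemma partial_deriv_barrier:
  "partial_deriv i (\<lambda>x. barrier T \<alpha> \<gamma> \<beta> z (x, t)) x = ((2 * \<gamma>) *\<^sub>R x + (2 * \<beta>) *\<^sub>R (x - z)) $ i"
  unfolding barrier_def partial_deriv_def prod.case
  by (rule DERIV_imp_deriv)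
    (auto intro!: derivative_eq_intros simp: inner_axis inner_axis' algebra_simps)

lemma gradient_barrier:
  "gradient (\<lambda>x. barrier T \<alpha> \<gamma> \<beta> z (x, t)) x = (2 * \<gamma>) *\<^sub>R x + (2 * \<beta>) *\<^sub>R (x - z)"
  by (simp add: gradient_def partial_deriv_barrier vec_eq_iff)

lemma hessian_barrier:
  "hessian (\<lambda>x. barrier T \<alpha> \<gamma> \<beta> z (x, t)) x = (2 * (\<gamma> + \<beta>)) *\<^sub>R mat 1"
proof -
  have "partial_deriv i (\<lambda>x. ((2 * \<gamma>) *\<^sub>R x + (2 * \<beta>) *\<^sub>R (x - z)) $ j) x = ((2 * (\<gamma> + \<beta>)) *\<^sub>R mat 1) $ i $ j" for i j
    unfolding partial_deriv_def
    by (rule DERIV_imp_deriv) (auto intro!: derivative_eq_intros simp: axis_def mat_def algebra_simps)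
  then show ?thesis
    by (simp add: hessian_def partial_deriv_barrier[abs_def] vec_eq_iff)
qed

section \<open>Interior cones and the one-sided maximum principle\<close>

lemma frontier_interior_cone:
  assumes "interior_cone_property \<Omega>" "y \<in> frontier \<Omega>"
  obtains \<nu> c where "c > 0" "\<And>\<tau>. 0 < \<tau> \<Longrightarrow> \<tau> \<le> c \<Longrightarrow> ball (y + \<tau> *\<^sub>R \<nu>) (c * \<tau>) \<subseteq> \<Omega>"
proof -
  \<comment> \<open>Positivity of \<open>s\<close> is carried along so that \<open>y\<close> lies in
    the ball around itself and the cone condition can be read off at \<open>y\<close>.\<close>
  have "\<forall>\<^sub>F s in at_right (0::real). s > 0 \<and> (\<exists>\<nu>. \<exists>c>0. continuous_on (closure \<Omega> \<inter> ball y s) \<nu> \<and>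
        (\<forall>y\<in>closure \<Omega> \<inter> ball y s. \<forall>\<tau>. 0 < \<tau> \<and> \<tau> \<le> c \<longrightarrow> ball (y + \<tau> *\<^sub>R \<nu> y) (c * \<tau>) \<subseteq> \<Omega>))"
    using assms unfolding interior_cone_property_def
    by (intro eventually_conj eventually_at_right_less) auto
  from eventually_happens'[OF trivial_limit_at_right_real this]
  obtain s \<nu> c where s: "s > 0" "c > 0"
    and *: "\<forall>y'\<in>closure \<Omega> \<inter> ball y s. \<forall>\<tau>. 0 < \<tau> \<and> \<tau> \<le> c \<longrightarrow> ball (y' + \<tau> *\<^sub>R \<nu> y') (c * \<tau>) \<subseteq> \<Omega>"
    by blast
  have "y \<in> closure \<Omega> \<inter> ball y s" using assms(2) s by (simp add: frontier_def)
  from *[rule_format, OF this] show ?thesis by (intro that[OF s(2), of "\<nu> y"]) auto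
qed

text \<open>The operator is abstract and its bounds are one-sided so that the result applies both to
  \<open>H\<close> and to its reflection \<open>- H x (- r) (- p) (- X)\<close>. Bounds at
  \<open>r = 0\<close> suffice, since monotonicity carries them to the positive values of
  \<open>v\<close> where a contradiction is sought. The condition \<open>X \<noteq> 0\<close> in
  \<open>small\<close> matches a punctured limit at the origin; the Hessian inserted there is a
  nonzero multiple of the identity.\<close>

lemma subsolution_nonpos:
  fixes \<Omega> :: "(real ^ 'n) set"
    and K :: "real ^ 'n \<Rightarrow> real \<Rightarrow> real ^ 'n \<Rightarrow> real ^ 'n ^ 'n \<Rightarrow> real"
  assumes "T > 0" "open \<Omega>" and cone: "interior_cone_property \<Omega>"
    and mono: "\<And>x p X. x \<in> \<Omega> \<Longrightarrow> X \<in> sym_matrices \<Longrightarrow> mono (\<lambda>r. K x r p X)"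
    and small: "\<And>\<epsilon>. \<epsilon> > 0 \<Longrightarrow> \<exists>d>0. \<forall>x\<in>\<Omega>. \<forall>p. \<forall>X\<in>sym_matrices.
        norm p < d \<longrightarrow> norm X < d \<longrightarrow> X \<noteq> 0 \<longrightarrow> - \<epsilon> \<le> K x 0 p X"
    and bdry: "\<And>\<omega> y \<epsilon>. modulus_of_continuity \<omega> \<Longrightarrow> y \<in> frontier \<Omega> \<Longrightarrow> \<epsilon> > 0 \<Longrightarrow>
        \<forall>\<^sub>F \<delta> in at_right 0. \<forall>x\<in>\<Omega>. \<forall>p. \<forall>X\<in>sym_matrices.
          norm (x - y) \<le> \<delta> \<longrightarrow> norm p \<le> \<omega> \<delta> / \<delta> \<longrightarrow> norm X \<le> \<omega> \<delta> / \<delta>\<^sup>2 \<longrightarrow> - \<epsilon> \<le> K x 0 p X"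
    and cont: "continuous_on (closure \<Omega> \<times> {0..<T}) v"
    and bound: "\<And>x t. x \<in> closure \<Omega> \<Longrightarrow> t \<in> {0..<T} \<Longrightarrow> v (x, t) \<le> B"
    and init: "\<And>x. x \<in> closure \<Omega> \<Longrightarrow> v (x, 0) \<le> 0"
    and sub: "\<And>\<alpha> \<gamma> \<beta> z x t. x \<in> \<Omega> \<Longrightarrow> t \<in> {0<..<T} \<Longrightarrow>
        local_max_at (\<Omega> \<times> {0<..<T}) (\<lambda>w. v w - barrier T \<alpha> \<gamma> \<beta> z w) (x, t) \<Longrightarrow>
        \<alpha> / (T - t)\<^sup>2 + K x (v (x, t)) ((2 * \<gamma>) *\<^sub>R x + (2 * \<beta>) *\<^sub>R (x - z)) ((2 * (\<gamma> + \<beta>)) *\<^sub>R mat 1) \<le> 0"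
    and xt: "x \<in> closure \<Omega>" "t \<in> {0..<T}"
  shows "v (x, t) \<le> 0"
proof (rule ccontr)
  define I :: "real ^ 'n ^ 'n" where "I = mat 1"
  have I_sym: "a *\<^sub>R I \<in> sym_matrices" for a
    by (simp add: I_def sym_matrices_def transpose_scalar)
  have I_nz: "a *\<^sub>R I \<noteq> 0" if "a \<noteq> 0" for a
    using that by (auto simp: I_def vec_eq_iff mat_def)
  define N where "N = norm I"
  have N: "N \<ge> 0" by (simp add: N_def)
  define m where "m = v (x, t)"
  assume "\<not> v (x, t) \<le> 0"
  then have m: "0 < m" by (simp add: m_def)
  have mB: "m \<le> B" using bound xt by (auto simp: m_def)
  have B: "B > 0" using m mB by linarith
  \<comment> \<open>With this choice the time penalty at \<open>(x, t)\<close> is exactly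
    \<open>m / 4\<close>, so the penalised function stays positive there.\<close>
  define \<alpha> where "\<alpha> = m * (T - t) / 4"
  have \<alpha>: "\<alpha> > 0" using m xt by (simp add: \<alpha>_def)
  \<comment> \<open>Half of \<open>\<alpha> / T\<^sup>2\<close>, the least value of the time
    derivative \<open>\<alpha> / (T - s)\<^sup>2\<close> of the barrier on \<open>[0, T)\<close>. An
    operator value of at least \<open>- \<epsilon>\<close> therefore cannot cancel that
    derivative.\<close>
  define \<epsilon> where "\<epsilon> = \<alpha> / (2 * T\<^sup>2)"
  have \<epsilon>: "\<epsilon> > 0" using \<alpha> \<open>T > 0\<close> by (simp add: \<epsilon>_def)
  obtain d where d: "d > 0" and small_d: "\<And>x p X. x \<in> \<Omega> \<Longrightarrow> X \<in> sym_matrices \<Longrightarrow>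
        norm p < d \<Longrightarrow> norm X < d \<Longrightarrow> X \<noteq> 0 \<Longrightarrow> - \<epsilon> \<le> K x 0 p X"
    using small[OF \<epsilon>] by blast
  have drift: "2 * \<epsilon> \<le> \<alpha> / (T - s)\<^sup>2" if "s \<in> {0..<T}" for s
  proof -
    have "2 * \<epsilon> = \<alpha> / T\<^sup>2" by (simp add: \<epsilon>_def)
    also have "\<dots> \<le> \<alpha> / (T - s)\<^sup>2"
      using that \<alpha> by (intro divide_left_mono power_mono mult_pos_pos) auto
    finally show ?thesis .
  qed
  \<comment> \<open>The second condition keeps the penalised function positive at
    \<open>(x, t)\<close>. The last two make the gradient \<open>2 \<gamma> y\<close> and the
    Hessian \<open>2 \<gamma> I\<close> smaller than \<open>d\<close>; the gradient estimate uses
    that \<open>\<gamma> \<bar>y\<bar>\<^sup>2\<close> is at most \<open>B\<close> at the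
    maximum.\<close>
  obtain \<gamma> where \<gamma>: "\<gamma> > 0" "\<gamma> * (norm x)\<^sup>2 < m / 4" "4 * \<gamma> * B < d\<^sup>2" "2 * \<gamma> * N < d"
  proof -
    have "\<forall>\<^sub>F \<gamma> in at_right 0. \<gamma> * (norm x)\<^sup>2 < m / 4"
      by (rule order_tendstoD) (use m in \<open>auto intro!: tendsto_eq_intros\<close>)
    moreover have "\<forall>\<^sub>F \<gamma> in at_right 0. 4 * \<gamma> * B < d\<^sup>2"
      by (rule order_tendstoD) (use d in \<open>auto intro!: tendsto_eq_intros\<close>)
    moreover have "\<forall>\<^sub>F \<gamma> in at_right 0. 2 * \<gamma> * N < d"
      by (rule order_tendstoD) (use d in \<open>auto intro!: tendsto_eq_intros\<close>)
    ultimately have "\<forall>\<^sub>F \<gamma> in at_right 0. 0 < \<gamma> \<and> \<gamma> * (norm x)\<^sup>2 < m / 4 \<and> 4 * \<gamma> * B < d\<^sup>2 \<and> 2 * \<gamma> * N < d"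
      using eventually_at_right_less[of "0::real"] by eventually_elim auto
    then show ?thesis
      using that eventually_happens'[OF trivial_limit_at_right_real] by blast
  qed
  define \<Phi> where "\<Phi> w = v w - barrier T \<alpha> \<gamma> 0 0 w" for w
  have \<Phi>: "\<Phi> (x, s) = v (x, s) - \<alpha> / (T - s) - \<gamma> * (norm x)\<^sup>2" for x s
    by (simp add: \<Phi>_def barrier_def power2_norm_eq_inner)
  have \<Phi>_barrier: "v (x, s) - barrier T \<alpha> \<gamma> \<beta> z (x, s) = \<Phi> (x, s) - \<beta> * (norm (x - z))\<^sup>2" for x s \<beta> z
    by (simp add: \<Phi>_def barrier_def power2_norm_eq_inner)
  have \<Phi>_le_v: "\<Phi> (x, s) \<le> v (x, s) - \<gamma> * (norm x)\<^sup>2" if "s \<in> {0..<T}" for x s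
    using that \<alpha> by (simp add: \<Phi>)
  have \<Phi>_le_v': "\<Phi> (x, s) \<le> v (x, s)" if "s \<in> {0..<T}" for x s
    using \<Phi>_le_v[OF that, of x] \<gamma>(1) by (smt (verit) mult_nonneg_nonneg zero_le_power2)
  have cont_\<Phi>: "continuous_on (closure \<Omega> \<times> {0..<T}) \<Phi>"
    unfolding \<Phi>_def barrier_def case_prod_beta by (intro continuous_intros cont) auto
  \<comment> \<open>From this time on the time penalty is at least \<open>B\<close>, the upper bound
    of \<open>v\<close>.\<close>
  define T' where "T' = T - \<alpha> / B"
  have "T' < T" using \<alpha> B by (simp add: T'_def)
  have late: "\<Phi> (x, s) \<le> 0" if "x \<in> closure \<Omega>" "s \<in> {0..<T}" "T' \<le> s" for x s
  proof -
    have "B \<le> \<alpha> / (T - s)"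
      using that B by (simp add: T'_def field_simps)
    then show ?thesis
      using bound[OF that(1,2)] \<gamma>(1) unfolding \<Phi> by (smt (verit) mult_nonneg_nonneg zero_le_power2)
  qed
  have start: "\<Phi> (x, 0) < 0" if "x \<in> closure \<Omega>" for x
    using init[OF that] \<Phi>[of x 0] \<alpha> \<gamma>(1) \<open>T > 0\<close>
    by (smt (verit) divide_pos_pos mult_nonneg_nonneg zero_le_power2)
  have far: "(norm x)\<^sup>2 < B / \<gamma>" if "x \<in> closure \<Omega>" "s \<in> {0..<T}" "0 < \<Phi> (x, s)" for x s
    using \<Phi>_le_v[OF that(2), of x] bound[OF that(1,2)] that(3) \<gamma>(1) by (simp add: field_simps)
  have \<Phi>_xt: "m / 4 < \<Phi> (x, t)"
  proof -
    have "\<alpha> / (T - t) = m / 4" using xt by (simp add: \<alpha>_def nonzero_divide_eq_eq)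
    then show ?thesis using \<gamma>(2) m by (simp add: \<Phi> m_def[symmetric])
  qed
  txt \<open>Outside \<open>C\<close> the function \<open>\<Phi>\<close> is nonpositive, so its maximum over \<open>C\<close> is global.\<close>
  define C where "C = (closure \<Omega> \<inter> cball 0 (sqrt (B / \<gamma>))) \<times> {0..T'}"
  have in_C: "(x, s) \<in> C" if "x \<in> closure \<Omega>" "s \<in> {0..<T}" "0 < \<Phi> (x, s)" for x s
  proof -
    have "norm x \<le> sqrt (B / \<gamma>)" using far[OF that] by (intro real_le_rsqrt) simp
    moreover have "s \<le> T'" using late[OF that(1,2)] that(3) by linarith
    ultimately show ?thesis using that by (simp add: C_def)
  qed
  have "compact C"
    unfolding C_def by (intro compact_Times closed_Int_compact) auto
  moreover have "(x, t) \<in> C" using \<Phi>_xt m xt by (intro in_C) auto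
  moreover have "C \<subseteq> closure \<Omega> \<times> {0..<T}" using \<open>T' < T\<close> by (auto simp: C_def)
  ultimately have "\<exists>w\<in>C. \<forall>w'\<in>C. \<Phi> w' \<le> \<Phi> w"
    using cont_\<Phi> by (intro continuous_attains_sup) (auto intro: continuous_on_subset)
  then obtain y s where ys: "(y, s) \<in> C" and max_C: "\<And>w. w \<in> C \<Longrightarrow> \<Phi> w \<le> \<Phi> (y, s)"
    by (metis surj_pair)
  define M where "M = \<Phi> (y, s)"
  have M: "M > 0" using max_C[OF \<open>(x, t) \<in> C\<close>] \<Phi>_xt m by (simp add: M_def)
  have y: "y \<in> closure \<Omega>" and s: "s \<in> {0..<T}" using ys \<open>T' < T\<close> by (auto simp: C_def)
  have max: "\<Phi> (x, s) \<le> M" if "x \<in> closure \<Omega>" "s \<in> {0..<T}" for x s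
    using in_C[OF that] max_C[of "(x, s)"] M unfolding M_def by (cases "0 < \<Phi> (x, s)") auto
  \<comment> \<open>Positivity of \<Phi> forces \<open>v > 0\<close>, so the operator at
    \<open>v\<close> dominates the operator at 0, where the hypotheses give lower bounds.\<close>
  have K_ge: "K x 0 p (a *\<^sub>R I) \<le> K x (v (x, s)) p (a *\<^sub>R I)"
    if "x \<in> \<Omega>" "s \<in> {0..<T}" "0 < \<Phi> (x, s)" for x s p a
    using monoD[OF mono[OF that(1) I_sym], of 0 "v (x, s)"] \<Phi>_le_v'[OF that(2), of x] that(3) by simp
  \<comment> \<open>The initial condition makes \<Phi> negative at time 0, so a positive maximum
    occurs where the equation is available.\<close>
  have time_pos: "s \<in> {0<..<T}" if "x \<in> closure \<Omega>" "s \<in> {0..<T}" "0 < \<Phi> (x, s)" for x s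
    using start[OF that(1)] that by (cases "s = 0") auto
  show False
  proof (cases "y \<in> \<Omega>")
    case True
    have s': "s \<in> {0<..<T}" using time_pos[OF y s] M by (simp add: M_def)
    have "local_max_at (\<Omega> \<times> {0<..<T}) (\<lambda>w. v w - barrier T \<alpha> \<gamma> 0 0 w) (y, s)"
      unfolding local_max_at_def \<Phi>_def[symmetric]
      using max closure_subset[of \<Omega>] by (intro exI[of _ 1]) (fastforce simp: M_def)
    from sub[OF True s' this] have "\<alpha> / (T - s)\<^sup>2 + K y (v (y, s)) ((2 * \<gamma>) *\<^sub>R y) ((2 * \<gamma>) *\<^sub>R I) \<le> 0"
      by (simp add: I_def)
    moreover have "- \<epsilon> \<le> K y 0 ((2 * \<gamma>) *\<^sub>R y) ((2 * \<gamma>) *\<^sub>R I)"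
    proof (rule small_d[OF True I_sym])
      have "(norm ((2 * \<gamma>) *\<^sub>R y))\<^sup>2 = 4 * \<gamma> * (\<gamma> * (norm y)\<^sup>2)"
        by (simp add: power_mult_distrib power2_eq_square)
      also have "\<dots> \<le> 4 * \<gamma> * B"
        using far[OF y s] M \<gamma>(1) by (intro mult_left_mono) (auto simp: M_def field_simps)
      also have "\<dots> < d\<^sup>2" by fact
      finally show "norm ((2 * \<gamma>) *\<^sub>R y) < d" using d by (rule power2_less_imp_less[OF _ less_imp_le])
      show "norm ((2 * \<gamma>) *\<^sub>R I) < d" using \<gamma> by (simp add: N_def)
      show "(2 * \<gamma>) *\<^sub>R I \<noteq> 0" using \<gamma> by (intro I_nz) auto
    qed
    ultimately show False
      using K_ge[OF True s M[unfolded M_def], of "(2 * \<gamma>) *\<^sub>R y" "2 * \<gamma>"] drift[OF s] \<epsilon> by linarith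
  next
    case False
    then have yF: "y \<in> frontier \<Omega>" using y \<open>open \<Omega>\<close> by (simp add: frontier_def interior_open)
    obtain \<nu> c where c: "c > 0" and ball: "\<And>\<tau>. 0 < \<tau> \<Longrightarrow> \<tau> \<le> c \<Longrightarrow> ball (y + \<tau> *\<^sub>R \<nu>) (c * \<tau>) \<subseteq> \<Omega>"
      using frontier_interior_cone[OF cone yF] by metis
    \<comment> \<open>Half the cone radius, so that even the closed ball lies in \<Omega> and a
      maximum over it exists.\<close>
    define r where "r \<tau> = c * \<tau> / 2" for \<tau>
    define z where "z \<tau> = y + \<tau> *\<^sub>R \<nu>" for \<tau>
    \<comment> \<open>Every point of the closed ball of radius \<open>r \<tau>\<close> around
      \<open>z \<tau>\<close> is within \<open>L * \<tau>\<close> of \<open>y\<close>: at most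
      \<open>c * \<tau> / 2\<close> to the centre, then \<open>\<tau> * norm \<nu>\<close> to
      \<open>y\<close>.\<close>
    define L where "L = norm \<nu> + c"
    have L: "L > 0" using c by (simp add: L_def add_nonneg_pos)
    have cball: "cball (z \<tau>) (r \<tau>) \<subseteq> \<Omega>" if "0 < \<tau>" "\<tau> \<le> c" for \<tau>
    proof -
      have "r \<tau> < c * \<tau>" using c that by (simp add: r_def)
      then have "cball (z \<tau>) (r \<tau>) \<subseteq> ball (z \<tau>) (c * \<tau>)" by auto
      then show ?thesis using ball[OF that] by (simp add: z_def)
    qed
    have small_\<tau>: "\<forall>\<^sub>F \<tau> in at_right 0. 0 < \<tau> \<and> \<tau> \<le> c"
      unfolding eventually_at_right_field using c by (intro exI[of _ c]) auto
    \<comment> \<open>The loss from moving to \<open>z \<tau>\<close>, plus \<tau>. The extra \<tau>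
      makes \<open>k \<tau>\<close> positive and lets the centre of the ball beat its bounding
      sphere strictly.\<close>
    define k where "k \<tau> = M - \<Phi> (z \<tau>, s) + \<tau>" for \<tau>
    have "((\<lambda>\<tau>. \<Phi> (z \<tau>, s)) \<longlongrightarrow> \<Phi> (y, s)) (at_right 0)"
    proof (rule continuous_on_tendsto_compose[OF cont_\<Phi>])
      show "((\<lambda>\<tau>. (z \<tau>, s)) \<longlongrightarrow> (y, s)) (at_right 0)"
        unfolding z_def by (auto intro!: tendsto_eq_intros)
      show "\<forall>\<^sub>F \<tau> in at_right 0. (z \<tau>, s) \<in> closure \<Omega> \<times> {0..<T}"
        using small_\<tau>
      proof eventually_elim
        case (elim \<tau>)
        then have "z \<tau> \<in> \<Omega>" using cball[of \<tau>] c by (auto simp: r_def)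
        then show ?case using s closure_subset[of \<Omega>] by auto
      qed
    qed (use y s in auto)
    then have k: "(k \<longlongrightarrow> 0) (at_right 0)"
      unfolding k_def by (auto intro!: tendsto_eq_intros simp: M_def)
    txt \<open>\<open>g \<tau>\<close> bounds \<open>\<delta>\<close> times the gradient plus \<open>\<delta>\<^sup>2\<close> times the Hessian of the test function
      below, where \<open>\<delta> = L \<tau>\<close> is the distance scale from \<open>y\<close>.\<close>
    define g where "g \<tau> = (L * \<tau>) * (2 * \<gamma> * (norm y + L * \<tau>)) + 4 * L * k \<tau> / c
        + 2 * N * L\<^sup>2 * (\<gamma> * \<tau>\<^sup>2 + 4 * k \<tau> / c\<^sup>2)" for \<tau>
    have "(g \<longlongrightarrow> 0) (at_right 0)"
      unfolding g_def using c by (auto intro!: tendsto_eq_intros k)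
    moreover have scale: "filterlim (\<lambda>\<tau>. a * \<tau>) (at_right 0) (at_right 0)" if "a > 0" for a :: real
      unfolding filterlim_at
    proof
      show "\<forall>\<^sub>F \<tau> in at_right 0. a * \<tau> \<in> {0<..} \<and> a * \<tau> \<noteq> 0"
        using eventually_at_right_less[of "0::real"] by eventually_elim (use that in auto)
    qed (auto intro!: tendsto_eq_intros)
    \<comment> \<open>The majorant is taken in the variable \<open>\<delta> = L * \<tau>\<close>,
      because \<open>bdry\<close> evaluates the modulus at the distance from the boundary
      point.\<close>
    ultimately have "((\<lambda>\<delta>. g (inverse L * \<delta>)) \<longlongrightarrow> 0) (at_right 0)"
      using filterlim_compose L positive_imp_inverse_positive by blast
    then obtain \<omega> where \<omega>: "modulus_of_continuity \<omega>"
      and maj: "\<forall>\<^sub>F \<delta> in at_right 0. g (inverse L * \<delta>) \<le> \<omega> \<delta>"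
      by (rule modulus_of_continuity_majorant)
    have L_lim: "filterlim (\<lambda>\<tau>. L * \<tau>) (at_right 0) (at_right 0)"
      by (rule scale[OF L])
    have "\<forall>\<^sub>F \<tau> in at_right 0. g (inverse L * (L * \<tau>)) \<le> \<omega> (L * \<tau>)"
      by (rule eventually_compose_filterlim[OF maj L_lim])
    \<comment> \<open>This keeps the doubly penalised function positive at the centre, hence \<Phi>
      positive at its maximum point.\<close>
    moreover have "\<forall>\<^sub>F \<tau> in at_right 0. k \<tau> < M"
      by (rule order_tendstoD(2)[OF k M])
    moreover have "\<forall>\<^sub>F \<tau> in at_right 0. \<forall>x\<in>\<Omega>. \<forall>p. \<forall>X\<in>sym_matrices.
          norm (x - y) \<le> L * \<tau> \<longrightarrow> norm p \<le> \<omega> (L * \<tau>) / (L * \<tau>) \<longrightarrow> norm X \<le> \<omega> (L * \<tau>) / (L * \<tau>)\<^sup>2 \<longrightarrow> - \<epsilon> \<le> K x 0 p X"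
      using bdry[OF \<omega> yF \<epsilon>] L_lim by (rule eventually_compose_filterlim)
    ultimately have "\<forall>\<^sub>F \<tau> in at_right 0. 0 < \<tau> \<and> \<tau> \<le> c \<and> k \<tau> < M \<and> g (inverse L * (L * \<tau>)) \<le> \<omega> (L * \<tau>) \<and>
        (\<forall>x\<in>\<Omega>. \<forall>p. \<forall>X\<in>sym_matrices. norm (x - y) \<le> L * \<tau> \<longrightarrow> norm p \<le> \<omega> (L * \<tau>) / (L * \<tau>) \<longrightarrow>
          norm X \<le> \<omega> (L * \<tau>) / (L * \<tau>)\<^sup>2 \<longrightarrow> - \<epsilon> \<le> K x 0 p X)"
      using small_\<tau> by eventually_elim blast
    then obtain \<tau> where \<tau>: "0 < \<tau>" "\<tau> \<le> c" and k_M: "k \<tau> < M"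
      and g_\<omega>': "g (inverse L * (L * \<tau>)) \<le> \<omega> (L * \<tau>)"
      and bdry_\<tau>: "\<forall>x\<in>\<Omega>. \<forall>p. \<forall>X\<in>sym_matrices. norm (x - y) \<le> L * \<tau> \<longrightarrow>
          norm p \<le> \<omega> (L * \<tau>) / (L * \<tau>) \<longrightarrow> norm X \<le> \<omega> (L * \<tau>) / (L * \<tau>)\<^sup>2 \<longrightarrow> - \<epsilon> \<le> K x 0 p X"
      using eventually_happens'[OF trivial_limit_at_right_real] by blast
    have g_\<omega>: "g \<tau> \<le> \<omega> (L * \<tau>)" using g_\<omega>' L by (simp add: mult.assoc[symmetric])
    have r: "r \<tau> > 0" using \<tau> c by (simp add: r_def)
    have z: "z \<tau> \<in> \<Omega>" using cball[OF \<tau>] r by (auto simp: r_def)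
    have zcl: "z \<tau> \<in> closure \<Omega>" using z closure_subset by auto
    have k_pos: "k \<tau> > 0" using max[OF zcl s] \<tau> by (simp add: k_def)
    \<comment> \<open>Normalised so that the new penalty equals \<open>k \<tau>\<close> on the
      sphere of radius \<open>r \<tau>\<close>.\<close>
    define \<beta> where "\<beta> = k \<tau> / (r \<tau>)\<^sup>2"
    have \<beta>: "\<beta> > 0" using k_pos r by (simp add: \<beta>_def)
    define \<Psi> where "\<Psi> w = \<Phi> w - \<beta> * (norm (fst w - z \<tau>))\<^sup>2" for w
    have \<Psi>_le: "\<Psi> w \<le> \<Phi> w" for w using \<beta> by (simp add: \<Psi>_def)
    define E where "E = cball (z \<tau>) (r \<tau>) \<times> {0..T'}"
    have E_sub: "E \<subseteq> closure \<Omega> \<times> {0..<T}"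
      using cball[OF \<tau>] closure_subset[of \<Omega>] \<open>T' < T\<close> by (force simp: E_def)
    have "compact E" unfolding E_def by (intro compact_Times) auto
    moreover have zs: "(z \<tau>, s) \<in> E" using ys r by (auto simp: E_def C_def)
    moreover have "continuous_on E \<Psi>"
      unfolding \<Psi>_def by (intro continuous_intros continuous_on_subset[OF cont_\<Phi> E_sub])
    ultimately have "\<exists>w\<in>E. \<forall>w'\<in>E. \<Psi> w' \<le> \<Psi> w"
      by (intro continuous_attains_sup) auto
    then obtain x' s' where E: "(x', s') \<in> E" and max_E: "\<And>w. w \<in> E \<Longrightarrow> \<Psi> w \<le> \<Psi> (x', s')"
      by (metis surj_pair)
    have \<Psi>_z: "\<Psi> (z \<tau>, s) = M - k \<tau> + \<tau>" by (simp add: \<Psi>_def k_def)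
    then have \<Psi>_max: "M - k \<tau> + \<tau> \<le> \<Psi> (x', s')" using max_E[OF zs] by simp
    have \<Phi>_pos: "0 < \<Phi> (x', s')" using \<Psi>_max \<Psi>_le[of "(x', s')"] k_M \<tau> by linarith
    have x'cl: "x' \<in> closure \<Omega>" and s': "s' \<in> {0..<T}" using E E_sub by auto
    have x': "x' \<in> \<Omega>" using E cball[OF \<tau>] by (auto simp: E_def)
    have s'_pos: "s' \<in> {0<..<T}" by (rule time_pos[OF x'cl s' \<Phi>_pos])
    have x'_z: "norm (x' - z \<tau>) \<le> r \<tau>" using E by (auto simp: E_def dist_norm norm_minus_commute)
    \<comment> \<open>On the sphere \<Psi> is at most \<open>M - k \<tau>\<close>, while at the
      centre it already reaches \<open>M - k \<tau> + \<tau>\<close>.\<close>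
    have "norm (x' - z \<tau>) \<noteq> r \<tau>"
    proof
      assume "norm (x' - z \<tau>) = r \<tau>"
      then have "\<Psi> (x', s') = \<Phi> (x', s') - k \<tau>" using r by (simp add: \<Psi>_def \<beta>_def)
      then show False using max[OF x'cl s'] \<Psi>_max \<tau> by linarith
    qed
    then have x'_ball: "x' \<in> ball (z \<tau>) (r \<tau>)" using x'_z by (simp add: dist_norm norm_minus_commute)
    then obtain e where e: "e > 0" "ball x' e \<subseteq> ball (z \<tau>) (r \<tau>)"
      using open_ball open_contains_ball by blast
    have "local_max_at (\<Omega> \<times> {0<..<T}) (\<lambda>w. v w - barrier T \<alpha> \<gamma> \<beta> (z \<tau>) w) (x', s')"
      unfolding local_max_at_def
    proof (intro exI[of _ e] conjI ballI)
      fix w assume w: "w \<in> \<Omega> \<times> {0<..<T} \<inter> ball (x', s') e"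
      obtain x'' s'' where w_eq: "w = (x'', s'')" by force
      have "dist x' x'' < e" using w dist_fst_le[of "(x', s')" w] by (simp add: w_eq)
      then have x'': "x'' \<in> cball (z \<tau>) (r \<tau>)" using e(2) by force
      \<comment> \<open>The maximum over \<open>E\<close> compares only times up to
        \<open>T'\<close>, and \<open>s'\<close> may equal \<open>T'\<close>. Later times are
        harmless since \<Phi> is nonpositive there and the maximum is positive.\<close>
      have "\<Psi> (x'', s'') \<le> \<Psi> (x', s')"
      proof (cases "s'' \<le> T'")
        case True
        then show ?thesis using w x'' by (intro max_E) (auto simp: E_def w_eq)
      next
        case False
        then have "\<Phi> (x'', s'') \<le> 0"
          using w closure_subset[of \<Omega>] by (intro late) (auto simp: w_eq)
        then show ?thesis using \<Psi>_le[of "(x'', s'')"] \<Psi>_max k_M \<tau> by linarith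
      qed
      then show "v w - barrier T \<alpha> \<gamma> \<beta> (z \<tau>) w \<le> v (x', s') - barrier T \<alpha> \<gamma> \<beta> (z \<tau>) (x', s')"
        by (simp add: w_eq \<Phi>_barrier \<Psi>_def)
    qed (fact e(1))
    from sub[OF x' s'_pos this]
    have eq: "\<alpha> / (T - s')\<^sup>2 + K x' (v (x', s')) ((2 * \<gamma>) *\<^sub>R x' + (2 * \<beta>) *\<^sub>R (x' - z \<tau>)) ((2 * (\<gamma> + \<beta>)) *\<^sub>R I) \<le> 0"
      (is "_ + K _ _ ?p ?X \<le> 0") by (simp add: I_def)
    have x'_y: "norm (x' - y) \<le> L * \<tau>"
    proof -
      have "norm (x' - y) \<le> norm (x' - z \<tau>) + norm (z \<tau> - y)"
        using norm_triangle_ineq[of "x' - z \<tau>" "z \<tau> - y"] by simp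
      also have "\<dots> \<le> c * \<tau> / 2 + \<tau> * norm \<nu>" using x'_z \<tau> by (simp add: r_def z_def)
      also have "\<dots> \<le> L * \<tau>" using c \<tau> by (simp add: L_def algebra_simps)
      finally show ?thesis .
    qed
    \<comment> \<open>The penalty contributes at most
      \<open>2 * \<beta> * r \<tau> = 4 * k \<tau> / (c * \<tau>)\<close>, which is only
      \<open>o(1 / \<tau>)\<close> because \<open>k \<tau>\<close> tends to 0. Multiplying by
      \<open>L * \<tau>\<close> gives the first two terms of \<open>g \<tau>\<close>; the Hessian
      bound accounts for the third.\<close>
    have norm_p: "norm ?p \<le> \<omega> (L * \<tau>) / (L * \<tau>)"
    proof -
      have "norm x' \<le> norm y + L * \<tau>"
        using norm_triangle_ineq[of y "x' - y"] x'_y by simp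
      then have "norm ?p \<le> 2 * \<gamma> * (norm y + L * \<tau>) + 2 * \<beta> * r \<tau>"
        using \<gamma>(1) \<beta> x'_z by (intro norm_triangle_le add_mono) auto
      also have "2 * \<beta> * r \<tau> = 4 * k \<tau> / (c * \<tau>)"
        using r c \<tau> by (simp add: \<beta>_def r_def field_simps power2_eq_square)
      also have "2 * \<gamma> * (norm y + L * \<tau>) + \<dots>
          = ((L * \<tau>) * (2 * \<gamma> * (norm y + L * \<tau>)) + 4 * L * k \<tau> / c) / (L * \<tau>)"
        using L c \<tau> by (simp add: field_simps)
      also have "\<dots> \<le> g \<tau> / (L * \<tau>)"
        using L \<tau> N \<gamma>(1) k_pos unfolding g_def by (intro divide_right_mono) auto
      also have "\<dots> \<le> \<omega> (L * \<tau>) / (L * \<tau>)" using g_\<omega> L \<tau> by (intro divide_right_mono) auto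
      finally show ?thesis .
    qed
    have norm_X: "norm ?X \<le> \<omega> (L * \<tau>) / (L * \<tau>)\<^sup>2"
    proof -
      have "norm ?X = 2 * N * (\<gamma> + \<beta>)" using \<gamma>(1) \<beta> by (simp add: N_def)
      also have "\<dots> = 2 * N * L\<^sup>2 * (\<gamma> * \<tau>\<^sup>2 + 4 * k \<tau> / c\<^sup>2) / (L * \<tau>)\<^sup>2"
        using L c \<tau> by (simp add: \<beta>_def r_def field_simps power2_eq_square)
      also have "\<dots> \<le> g \<tau> / (L * \<tau>)\<^sup>2"
        using L \<tau> c \<gamma>(1) k_pos unfolding g_def by (intro divide_right_mono) auto
      also have "\<dots> \<le> \<omega> (L * \<tau>) / (L * \<tau>)\<^sup>2" using g_\<omega> L \<tau> by (intro divide_right_mono) auto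
      finally show ?thesis .
    qed
    have "- \<epsilon> \<le> K x' 0 ?p ?X"
      using bdry_\<tau> x' I_sym x'_y norm_p norm_X by blast
    then show False
      using K_ge[OF x' s' \<Phi>_pos, of ?p "2 * (\<gamma> + \<beta>)"] drift[OF s'] eq \<epsilon> by linarith
  qed
qed

section \<open>Application to the solution and to its negative\<close>

lemma neg_sym_matrices: "- X \<in> sym_matrices \<longleftrightarrow> X \<in> sym_matrices"
  by (auto simp: sym_matrices_def transpose_def vec_eq_iff)

lemma abs_diff_le_boundary_oscillation:
  assumes "x \<in> \<Omega>" "y \<in> frontier \<Omega>" "norm (x - y) \<le> \<delta>" "norm p \<le> \<omega> \<delta> / \<delta>"
    "X \<in> sym_matrices" "norm X \<le> \<omega> \<delta> / \<delta>\<^sup>2"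
    and "boundary_oscillation \<Omega> H G \<omega> \<delta> < ennreal \<epsilon>"
  shows "\<bar>H x r p X - G y r\<bar> < \<epsilon>"
proof -
  have "ennreal \<bar>H x r p X - G y r\<bar> \<le> boundary_oscillation \<Omega> H G \<omega> \<delta>"
    unfolding boundary_oscillation_def using assms by (intro Sup_upper) blast
  also have "\<dots> < ennreal \<epsilon>" by fact
  finally show ?thesis by (simp add: ennreal_less_iff)
qed

lemma viscosity_subsolution_barrier:
  assumes "viscosity_subsolution \<Omega> T H u" "x \<in> \<Omega>" "t \<in> {0<..<T}"
    and "local_max_at (\<Omega> \<times> {0<..<T}) (\<lambda>w. u w - barrier T \<alpha> \<gamma> \<beta> z w) (x, t)"
  shows "\<alpha> / (T - t)\<^sup>2 + H x (u (x, t)) ((2 * \<gamma>) *\<^sub>R x + (2 * \<beta>) *\<^sub>R (x - z)) ((2 * (\<gamma> + \<beta>)) *\<^sub>R mat 1) \<le> 0"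
proof -
  have "deriv (\<lambda>t. barrier T \<alpha> \<gamma> \<beta> z (x, t)) t + H x (u (x, t))
      (gradient (\<lambda>x. barrier T \<alpha> \<gamma> \<beta> z (x, t)) x) (hessian (\<lambda>x. barrier T \<alpha> \<gamma> \<beta> z (x, t)) x) \<le> 0"
    using assms C2_on_barrier[of \<Omega> T \<alpha> \<gamma> \<beta> z] unfolding viscosity_subsolution_def by blast
  moreover have "t \<noteq> T" using assms(3) by auto
  ultimately show ?thesis by (simp add: deriv_barrier_time gradient_barrier hessian_barrier)
qed

lemma viscosity_supersolution_barrier:
  assumes "viscosity_supersolution \<Omega> T H u" "x \<in> \<Omega>" "t \<in> {0<..<T}"
    and "local_min_at (\<Omega> \<times> {0<..<T}) (\<lambda>w. u w - barrier T \<alpha> \<gamma> \<beta> z w) (x, t)"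
  shows "0 \<le> \<alpha> / (T - t)\<^sup>2 + H x (u (x, t)) ((2 * \<gamma>) *\<^sub>R x + (2 * \<beta>) *\<^sub>R (x - z)) ((2 * (\<gamma> + \<beta>)) *\<^sub>R mat 1)"
proof -
  have "deriv (\<lambda>t. barrier T \<alpha> \<gamma> \<beta> z (x, t)) t + H x (u (x, t))
      (gradient (\<lambda>x. barrier T \<alpha> \<gamma> \<beta> z (x, t)) x) (hessian (\<lambda>x. barrier T \<alpha> \<gamma> \<beta> z (x, t)) x) \<ge> 0"
    using assms C2_on_barrier[of \<Omega> T \<alpha> \<gamma> \<beta> z] unfolding viscosity_supersolution_def by blast
  moreover have "t \<noteq> T" using assms(3) by auto
  ultimately show ?thesis by (simp add: deriv_barrier_time gradient_barrier hessian_barrier)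
qed

theorem theorem4p4:
  fixes \<Omega> :: "(real ^ 'n) set" and T :: real
    and H :: "real ^ 'n \<Rightarrow> real \<Rightarrow> real ^ 'n \<Rightarrow> real ^ 'n ^ 'n \<Rightarrow> real"
    and G :: "real ^ 'n \<Rightarrow> real \<Rightarrow> real"
    and u :: "(real ^ 'n) \<times> real \<Rightarrow> real"
  assumes "T > 0"
    and "open \<Omega>" and "connected \<Omega>" and "\<Omega> \<noteq> {}"
    and "interior_cone_property \<Omega>"
    and "continuous_on (\<Omega> \<times> UNIV \<times> UNIV \<times> sym_matrices) (\<lambda>(x, r, p, X). H x r p X)"
    and "elliptic_on \<Omega> H"
    and "continuous_on (frontier \<Omega> \<times> UNIV) (\<lambda>(y, r). G y r)"
    and "\<And>\<omega>. modulus_of_continuity \<omega> \<Longrightarrow> (boundary_oscillation \<Omega> H G \<omega> \<longlongrightarrow> 0) (at_right 0)"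
    and "\<And>x p X. x \<in> \<Omega> \<Longrightarrow> X \<in> sym_matrices \<Longrightarrow> mono (\<lambda>r. H x r p X)"
    and "((\<lambda>(p, X). SUP x\<in>\<Omega>. ennreal \<bar>H x 0 p X\<bar>) \<longlongrightarrow> 0) (at (0, 0) within UNIV \<times> sym_matrices)"
    and "continuous_on (\<Omega> \<times> {0..<T}) u"
    and "bounded (u ` (\<Omega> \<times> {0..<T}))"
    and "viscosity_solution \<Omega> T H u"
    and "\<exists>v. continuous_on (closure \<Omega> \<times> {0..<T}) v \<and>
           (\<forall>z\<in>\<Omega> \<times> {0..<T}. v z = u z) \<and> (\<forall>x\<in>closure \<Omega>. v (x, 0) = 0)"
  shows "\<forall>x\<in>\<Omega>. \<forall>t\<in>{0..<T}. u (x, t) = 0"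
proof -
  note cone = assms(5) and osc = assms(9) and mono = assms(10) and lim0 = assms(11) and sol = assms(14)
  obtain v where cont: "continuous_on (closure \<Omega> \<times> {0..<T}) v"
    and v_u: "\<And>z. z \<in> \<Omega> \<times> {0..<T} \<Longrightarrow> v z = u z"
    and init: "\<And>x. x \<in> closure \<Omega> \<Longrightarrow> v (x, 0) = 0"
    using assms(15) by blast
  obtain B where B: "\<And>z. z \<in> \<Omega> \<times> {0..<T} \<Longrightarrow> norm (u z) \<le> B"
    using assms(13) by (auto simp: bounded_iff)
  have bound: "\<bar>v (x, t)\<bar> \<le> B" if "x \<in> closure \<Omega>" "t \<in> {0..<T}" for x t
  proof -
    \<comment> \<open>The bound passes from \<Omega> to its closure by continuity in space at each
      fixed time.\<close>
    have "continuous_on (closure \<Omega>) (\<lambda>x. v (x, t))"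
      using that by (intro continuous_on_compose2[OF cont] continuous_intros) auto
    then have "norm (v (x, t)) \<le> B"
      using that B v_u by (intro continuous_on_closure_norm_le[where s = \<Omega>]) auto
    then show ?thesis by simp
  qed
  have small: "\<exists>d>0. \<forall>x\<in>\<Omega>. \<forall>p. \<forall>X\<in>sym_matrices.
      norm p < d \<longrightarrow> norm X < d \<longrightarrow> X \<noteq> 0 \<longrightarrow> \<bar>H x 0 p X\<bar> < \<epsilon>" if "\<epsilon> > 0" for \<epsilon>
  proof -
    have "\<forall>\<^sub>F (p, X) in at (0, 0) within UNIV \<times> sym_matrices. (SUP x\<in>\<Omega>. ennreal \<bar>H x 0 p X\<bar>) < ennreal \<epsilon>"
      using order_tendstoD(2)[OF lim0, of "ennreal \<epsilon>"] that by (simp add: case_prod_beta')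
    then obtain d where d: "d > 0" and d_less: "\<And>p X. X \<in> sym_matrices \<Longrightarrow> (p, X) \<noteq> (0, 0) \<Longrightarrow>
        dist (p, X) (0, 0) < d \<Longrightarrow> (SUP x\<in>\<Omega>. ennreal \<bar>H x 0 p X\<bar>) < ennreal \<epsilon>"
      unfolding eventually_at by fastforce
    \<comment> \<open>Halving \<open>d\<close> controls the norm of the pair, and
      \<open>X \<noteq> 0\<close> keeps it off the origin, which the limit does not see.\<close>
    have "\<bar>H x 0 p X\<bar> < \<epsilon>"
      if "x \<in> \<Omega>" "X \<in> sym_matrices" "norm p < d / 2" "norm X < d / 2" "X \<noteq> 0" for x p X
    proof -
      have "dist (p, X) (0, 0) < d"
        using norm_Pair_le[of p X] that by (simp add: dist_norm)
      then have "(SUP x\<in>\<Omega>. ennreal \<bar>H x 0 p X\<bar>) < ennreal \<epsilon>" using that by (intro d_less) auto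
      then have "ennreal \<bar>H x 0 p X\<bar> < ennreal \<epsilon>"
        using SUP_upper[OF that(1)] by (rule le_less_trans[rotated])
      then show ?thesis by (simp add: ennreal_less_iff)
    qed
    then show ?thesis using d by (intro exI[of _ "d / 2"]) auto
  qed
  have osc_ev: "\<forall>\<^sub>F \<delta> in at_right 0. boundary_oscillation \<Omega> H G \<omega> \<delta> < ennreal \<epsilon>"
    if "modulus_of_continuity \<omega>" "\<epsilon> > 0" for \<omega> \<epsilon>
    using osc[OF that(1)] that(2) by (intro order_tendstoD) auto
  \<comment> \<open>Near \<open>y\<close>, a value \<open>H x 0 0 X\<close> with small nonzero
    \<open>X\<close> is close to 0 by the limit at the origin and close to \<open>G y 0\<close> by
    the boundary condition.\<close>
  have G0: "G y 0 = 0" if y: "y \<in> frontier \<Omega>" for y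
  proof -
    have "\<bar>G y 0\<bar> < 2 * \<epsilon>" if \<epsilon>: "\<epsilon> > 0" for \<epsilon>
    proof -
      obtain d where d: "d > 0" and d_less: "\<And>x p X. x \<in> \<Omega> \<Longrightarrow> X \<in> sym_matrices \<Longrightarrow>
          norm p < d \<Longrightarrow> norm X < d \<Longrightarrow> X \<noteq> 0 \<Longrightarrow> \<bar>H x 0 p X\<bar> < \<epsilon>"
        using small[OF \<epsilon>] by blast
      have "modulus_of_continuity (\<lambda>s. s)"
        by (auto simp: modulus_of_continuity_def mono_on_def)
      from osc_ev[OF this \<epsilon>]
      obtain \<delta> where \<delta>: "\<delta> > 0" "boundary_oscillation \<Omega> H G (\<lambda>s. s) \<delta> < ennreal \<epsilon>"
        using eventually_happens'[OF trivial_limit_at_right_real] eventually_conj eventually_at_right_less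
        by (metis (mono_tags, lifting))
      obtain x where x: "x \<in> \<Omega>" "dist x y < \<delta>"
        using y \<delta>(1) by (auto simp: frontier_def closure_approachable)
      \<comment> \<open>Scales the identity to norm \<open>min (d / 2) (1 / \<delta>)\<close>: below
        \<open>d\<close> for the limit at the origin, and at most
        \<open>\<omega> \<delta> / \<delta>\<^sup>2 = 1 / \<delta>\<close> for the modulus
        \<open>\<omega> s = s\<close>.\<close>
      define a where "a = min (d / 2) (1 / \<delta>) / norm (mat 1 :: real ^ 'n ^ 'n)"
      have I: "(mat 1 :: real ^ 'n ^ 'n) \<noteq> 0" by (auto simp: vec_eq_iff mat_def)
      have a: "a > 0" using d \<delta> I by (simp add: a_def)
      define X :: "real ^ 'n ^ 'n" where "X = a *\<^sub>R mat 1"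
      have X: "X \<in> sym_matrices" "X \<noteq> 0"
        using a I by (auto simp: X_def sym_matrices_def transpose_scalar)
      have "norm X = min (d / 2) (1 / \<delta>)"
        using a I by (simp add: X_def) (simp add: a_def)
      with X have X: "X \<in> sym_matrices" "X \<noteq> 0" "norm X \<le> 1 / \<delta>" "norm X < d" using d by auto
      have "\<bar>H x 0 0 X - G y 0\<bar> < \<epsilon>"
        by (rule abs_diff_le_boundary_oscillation[OF x(1) y _ _ X(1) _ \<delta>(2)])
          (use x X \<delta> in \<open>auto simp: dist_norm power2_eq_square\<close>)
      moreover have "\<bar>H x 0 0 X\<bar> < \<epsilon>" using X d by (intro d_less x) auto
      ultimately show ?thesis by linarith
    qed
    from this[of "\<bar>G y 0\<bar> / 2"] show ?thesis by (cases "G y 0 = 0") auto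
  qed
  \<comment> \<open>As \<open>G y 0\<close> vanishes, small oscillation at the boundary means that
    \<open>H\<close> itself is small at \<open>r = 0\<close>.\<close>
  have bdry: "\<forall>\<^sub>F \<delta> in at_right 0. \<forall>x\<in>\<Omega>. \<forall>p. \<forall>X\<in>sym_matrices.
      norm (x - y) \<le> \<delta> \<longrightarrow> norm p \<le> \<omega> \<delta> / \<delta> \<longrightarrow> norm X \<le> \<omega> \<delta> / \<delta>\<^sup>2 \<longrightarrow> \<bar>H x 0 p X\<bar> < \<epsilon>"
    if "modulus_of_continuity \<omega>" "y \<in> frontier \<Omega>" "\<epsilon> > 0" for \<omega> y \<epsilon>
    using osc_ev[OF that(1,3)]
  proof eventually_elim
    case (elim \<delta>)
    then show ?case
      using abs_diff_le_boundary_oscillation[OF _ that(2) _ _ _ _ elim, of _ _ _ 0] G0[OF that(2)] by auto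
  qed
  have upper: "v (x, t) \<le> 0" if xt: "x \<in> closure \<Omega>" "t \<in> {0..<T}" for x t
  proof (rule subsolution_nonpos[where K = H and B = B, OF assms(1,2) cone mono _ _ cont _ _ _ xt])
    show "\<exists>d>0. \<forall>x\<in>\<Omega>. \<forall>p. \<forall>X\<in>sym_matrices.
        norm p < d \<longrightarrow> norm X < d \<longrightarrow> X \<noteq> 0 \<longrightarrow> - \<epsilon> \<le> H x 0 p X" if "\<epsilon> > 0" for \<epsilon>
      using small[OF that] by (fastforce simp: abs_less_iff)
    show "\<forall>\<^sub>F \<delta> in at_right 0. \<forall>x\<in>\<Omega>. \<forall>p. \<forall>X\<in>sym_matrices.
        norm (x - y) \<le> \<delta> \<longrightarrow> norm p \<le> \<omega> \<delta> / \<delta> \<longrightarrow> norm X \<le> \<omega> \<delta> / \<delta>\<^sup>2 \<longrightarrow> - \<epsilon> \<le> H x 0 p X"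
      if "modulus_of_continuity \<omega>" "y \<in> frontier \<Omega>" "\<epsilon> > 0" for \<omega> y \<epsilon>
      using bdry[OF that] by eventually_elim (fastforce simp: abs_less_iff)
    show "v (x, t) \<le> B" if "x \<in> closure \<Omega>" "t \<in> {0..<T}" for x t
      using bound[OF that] by linarith
    show "v (x, 0) \<le> 0" if "x \<in> closure \<Omega>" for x using init[OF that] by simp
    fix \<alpha> \<gamma> \<beta> z x t
    assume x: "x \<in> \<Omega>" and t: "t \<in> {0<..<T}"
      and max: "local_max_at (\<Omega> \<times> {0<..<T}) (\<lambda>w. v w - barrier T \<alpha> \<gamma> \<beta> z w) (x, t)"
    have "local_max_at (\<Omega> \<times> {0<..<T}) (\<lambda>w. u w - barrier T \<alpha> \<gamma> \<beta> z w) (x, t)"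
    proof -
      obtain r where "r > 0" and r: "\<And>w. w \<in> \<Omega> \<times> {0<..<T} \<inter> ball (x, t) r \<Longrightarrow>
          v w - barrier T \<alpha> \<gamma> \<beta> z w \<le> v (x, t) - barrier T \<alpha> \<gamma> \<beta> z (x, t)"
        using max unfolding local_max_at_def by blast
      have "u w - barrier T \<alpha> \<gamma> \<beta> z w \<le> u (x, t) - barrier T \<alpha> \<gamma> \<beta> z (x, t)"
        if "w \<in> \<Omega> \<times> {0<..<T} \<inter> ball (x, t) r" for w
      proof -
        have "v w = u w" "v (x, t) = u (x, t)" using that x t by (auto intro!: v_u)
        then show ?thesis using r[OF that] by simp
      qed
      then show ?thesis using \<open>r > 0\<close> unfolding local_max_at_def by blast
    qed
    then show "\<alpha> / (T - t)\<^sup>2 + H x (v (x, t)) ((2 * \<gamma>) *\<^sub>R x + (2 * \<beta>) *\<^sub>R (x - z)) ((2 * (\<gamma> + \<beta>)) *\<^sub>R mat 1) \<le> 0"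
      using sol x t viscosity_subsolution_barrier[of \<Omega> T H u x t] by (auto simp: viscosity_solution_def v_u)
  qed
  txt \<open>The lower bound is the upper bound for \<open>- v\<close>, which solves the equation with operator
    \<open>- H (x, - r, - p, - X)\<close>.\<close>
  have lower: "- v (x, t) \<le> 0" if xt: "x \<in> closure \<Omega>" "t \<in> {0..<T}" for x t
  proof (rule subsolution_nonpos[where K = "\<lambda>x r p X. - H x (- r) (- p) (- X)" and B = B
        and v = "\<lambda>w. - v w", OF assms(1,2) cone _ _ _ _ _ _ _ xt])
    show "mono (\<lambda>r. - H x (- r) (- p) (- X))" if "x \<in> \<Omega>" "X \<in> sym_matrices" for x p X
      using monoD[OF mono[OF that(1), of "- X"]] that(2) by (auto intro!: monoI simp: neg_sym_matrices)
    show "\<exists>d>0. \<forall>x\<in>\<Omega>. \<forall>p. \<forall>X\<in>sym_matrices.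
        norm p < d \<longrightarrow> norm X < d \<longrightarrow> X \<noteq> 0 \<longrightarrow> - \<epsilon> \<le> - H x (- 0) (- p) (- X)" if \<epsilon>: "\<epsilon> > 0" for \<epsilon>
    proof -
      obtain d where d: "d > 0" and d_less: "\<And>x p X. x \<in> \<Omega> \<Longrightarrow> X \<in> sym_matrices \<Longrightarrow>
          norm p < d \<Longrightarrow> norm X < d \<Longrightarrow> X \<noteq> 0 \<Longrightarrow> \<bar>H x 0 p X\<bar> < \<epsilon>"
        using small[OF \<epsilon>] by blast
      show ?thesis
      proof (intro exI[of _ d] conjI ballI allI impI)
        fix x p :: "real ^ 'n" and X :: "real ^ 'n ^ 'n" assume "x \<in> \<Omega>" "X \<in> sym_matrices" "norm p < d" "norm X < d" "X \<noteq> 0"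
        then show "- \<epsilon> \<le> - H x (- 0) (- p) (- X)"
          using d_less[of x "- X" "- p"] by (simp add: neg_sym_matrices)
      qed (rule d)
    qed
    show "\<forall>\<^sub>F \<delta> in at_right 0. \<forall>x\<in>\<Omega>. \<forall>p. \<forall>X\<in>sym_matrices.
        norm (x - y) \<le> \<delta> \<longrightarrow> norm p \<le> \<omega> \<delta> / \<delta> \<longrightarrow> norm X \<le> \<omega> \<delta> / \<delta>\<^sup>2 \<longrightarrow> - \<epsilon> \<le> - H x (- 0) (- p) (- X)"
      if "modulus_of_continuity \<omega>" "y \<in> frontier \<Omega>" "\<epsilon> > 0" for \<omega> y \<epsilon>
      using bdry[OF that]
    proof eventually_elim
      case (elim \<delta>)
      show ?case
      proof (intro ballI allI impI)
        fix x p :: "real ^ 'n" and X :: "real ^ 'n ^ 'n"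
        assume "x \<in> \<Omega>" "X \<in> sym_matrices" "norm (x - y) \<le> \<delta>" "norm p \<le> \<omega> \<delta> / \<delta>" "norm X \<le> \<omega> \<delta> / \<delta>\<^sup>2"
        then show "- \<epsilon> \<le> - H x (- 0) (- p) (- X)"
          using elim[rule_format, of x "- X" "- p"] by (simp add: neg_sym_matrices)
      qed
    qed
    show "continuous_on (closure \<Omega> \<times> {0..<T}) (\<lambda>w. - v w)" by (intro continuous_intros cont)
    show "- v (x, t) \<le> B" if "x \<in> closure \<Omega>" "t \<in> {0..<T}" for x t
      using bound[OF that] by linarith
    show "- v (x, 0) \<le> 0" if "x \<in> closure \<Omega>" for x using init[OF that] by simp
    fix \<alpha> \<gamma> \<beta> z x t
    assume x: "x \<in> \<Omega>" and t: "t \<in> {0<..<T}"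
      and max: "local_max_at (\<Omega> \<times> {0<..<T}) (\<lambda>w. - v w - barrier T \<alpha> \<gamma> \<beta> z w) (x, t)"
    \<comment> \<open>A maximum of \<open>- v\<close> minus a barrier is a minimum of
      \<open>u\<close> minus the negated barrier, which belongs to the same family; its gradient and
      Hessian are the arguments \<open>- p\<close> and \<open>- X\<close> of the reflected
      operator.\<close>
    have "local_min_at (\<Omega> \<times> {0<..<T}) (\<lambda>w. u w - barrier T (- \<alpha>) (- \<gamma>) (- \<beta>) z w) (x, t)"
    proof -
      obtain r where "r > 0" and r: "\<And>w. w \<in> \<Omega> \<times> {0<..<T} \<inter> ball (x, t) r \<Longrightarrow>
          - v w - barrier T \<alpha> \<gamma> \<beta> z w \<le> - v (x, t) - barrier T \<alpha> \<gamma> \<beta> z (x, t)"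
        using max unfolding local_max_at_def by blast
      have "u (x, t) - barrier T (- \<alpha>) (- \<gamma>) (- \<beta>) z (x, t) \<le> u w - barrier T (- \<alpha>) (- \<gamma>) (- \<beta>) z w"
        if "w \<in> \<Omega> \<times> {0<..<T} \<inter> ball (x, t) r" for w
      proof -
        have "v w = u w" "v (x, t) = u (x, t)" using that x t by (auto intro!: v_u)
        then show ?thesis using r[OF that] by (simp add: barrier_uminus)
      qed
      then show ?thesis using \<open>r > 0\<close> unfolding local_min_at_def by blast
    qed
    then have "0 \<le> - \<alpha> / (T - t)\<^sup>2 + H x (u (x, t)) ((2 * - \<gamma>) *\<^sub>R x + (2 * - \<beta>) *\<^sub>R (x - z)) ((2 * (- \<gamma> + - \<beta>)) *\<^sub>R mat 1)"
      using sol x t by (intro viscosity_supersolution_barrier) (auto simp: viscosity_solution_def)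
    also have "(2 * - \<gamma>) *\<^sub>R x + (2 * - \<beta>) *\<^sub>R (x - z) = - ((2 * \<gamma>) *\<^sub>R x + (2 * \<beta>) *\<^sub>R (x - z))"
      by simp
    also have "(2 * (- \<gamma> + - \<beta>)) *\<^sub>R mat 1 = - ((2 * (\<gamma> + \<beta>)) *\<^sub>R mat 1)"
      unfolding scaleR_minus_left[symmetric] by (simp add: algebra_simps)
    finally show "\<alpha> / (T - t)\<^sup>2 + - H x (- (- v (x, t))) (- ((2 * \<gamma>) *\<^sub>R x + (2 * \<beta>) *\<^sub>R (x - z)))
        (- ((2 * (\<gamma> + \<beta>)) *\<^sub>R mat 1)) \<le> 0"
      using x t by (simp add: v_u)
  qed
  show ?thesis
  proof (intro ballI)
    fix x t assume xt: "x \<in> \<Omega>" "t \<in> {0..<T}"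
    then have "x \<in> closure \<Omega>" using closure_subset by auto
    then have "v (x, t) = 0" using upper[of x t] lower[of x t] xt(2) by simp
    then show "u (x, t) = 0" using v_u[of "(x, t)"] xt by simp
  qed
qed

end
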